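(* Every all-set-homogeneous geodesic space has locally unique geodesics.
   Context: $|x-y|$ denotes the distance between points $x,y$. An isometry is a bijective distance-preserving map. A metric space $M$ is all-set-homogeneous if every isometry between two subsets of $M$ extends to an isometry $M\to M$. A geodesic in $M$ is a distance-preserving map from a real interval to $M$; the image of a geodesic with endpoints $x,y$ is denoted $[xy]$ and is also called a geodesic. $M$ is a geodesic space if any two points are the endpoints of some geodesic. $M$ has locally unique geodesics if every point $p\in M$ has a neighborhood $U$ such that for any $x,y\in U$ the geodesic $[xy]$ in $M$ is unique. *)

theory Defs
  imports "HOL-Analysis.Analysis"
begin

text \<open>A metric space is a set \<open>M :: 'a::metric_space set\<close> with the restricted distance;
  topological notions are relative to \<open>M\<close>.\<close>

definition distance_preserving_on :: "'a::metric_space set \<Rightarrow> ('a \<Rightarrow> 'b::metric_space) \<Rightarrow> bool" where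
  "distance_preserving_on A f \<longleftrightarrow> (\<forall>x\<in>A. \<forall>y\<in>A. dist (f x) (f y) = dist x y)"

definition isometry_between ::
    "'a::metric_space set \<Rightarrow> 'b::metric_space set \<Rightarrow> ('a \<Rightarrow> 'b) \<Rightarrow> bool" where
  "isometry_between A B f \<longleftrightarrow> bij_betw f A B \<and> distance_preserving_on A f"

definition all_set_homogeneous :: "'a::metric_space set \<Rightarrow> bool" where
  "all_set_homogeneous M \<longleftrightarrow>
     (\<forall>A B f. A \<subseteq> M \<longrightarrow> B \<subseteq> M \<longrightarrow> isometry_between A B f \<longrightarrow>
        (\<exists>g. isometry_between M M g \<and> (\<forall>x\<in>A. g x = f x)))"

definition geodesic_on :: "'a::metric_space set \<Rightarrow> real set \<Rightarrow> (real \<Rightarrow> 'a) \<Rightarrow> bool" where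
  "geodesic_on M I \<gamma> \<longleftrightarrow> is_interval I \<and> \<gamma> ` I \<subseteq> M \<and> distance_preserving_on I \<gamma>"

text \<open>\<open>S\<close> is a geodesic \<open>[xy]\<close> in \<open>M\<close>, understood as a point set. Having both endpoints forces
  the parameter interval to be compact. No separate treatment of the opposite orientation is
  needed, as \<open>\<lambda>t. \<gamma> (- t)\<close> traverses the same set from \<open>y\<close> to \<open>x\<close>.\<close>

definition geodesic_between :: "'a::metric_space set \<Rightarrow> 'a \<Rightarrow> 'a \<Rightarrow> 'a set \<Rightarrow> bool" where
  "geodesic_between M x y S \<longleftrightarrow>
     (\<exists>a b \<gamma>. a \<le> b \<and> geodesic_on M {a..b} \<gamma> \<and> \<gamma> a = x \<and> \<gamma> b = y \<and> S = \<gamma> ` {a..b})"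

definition geodesic_space :: "'a::metric_space set \<Rightarrow> bool" where
  "geodesic_space M \<longleftrightarrow> (\<forall>x\<in>M. \<forall>y\<in>M. \<exists>S. geodesic_between M x y S)"

definition locally_unique_geodesics :: "'a::metric_space set \<Rightarrow> bool" where
  "locally_unique_geodesics M \<longleftrightarrow>
     (\<forall>p\<in>M. \<exists>U V. openin (top_of_set M) V \<and> p \<in> V \<and> V \<subseteq> U \<and> U \<subseteq> M \<and>
        (\<forall>x\<in>U. \<forall>y\<in>U. \<exists>!S. geodesic_between M x y S))"

end

theory Submission
  imports Defs
begin

text \<open>Call \<open>z\<close> a hub of \<open>p, q\<close> over \<open>w\<close> if it lies on geodesics from \<open>w\<close> to both \<open>p\<close> and \<open>q\<close>.
  By homogeneity the farthest hub \<open>v\<close> exists, and \<open>dist p q\<close> is a function of the lengths of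
  the arms \<open>v p\<close> and \<open>v q\<close>: if it were smaller than for another such pair, then that pair,
  cut back to the right distance, would move the hub farther out. Nonunique geodesics
  between close points make every arm split into a pair of arms with the same farthest hub \<open>v\<close>.
  Take a maximal family \<open>X\<close> of arms of length \<open>t\<close> over \<open>v\<close>, pairwise with farthest hub \<open>v\<close>, all on the way to
  a point \<open>P\<close> at distance \<open>2 * t\<close>. Since arms of equal length are indistinguishable, one finds
  \<open>y\<close> and \<open>z\<close> such that \<open>P, y, z\<close> share arms of length \<open>t\<close> pairwise but no element of \<open>X\<close> is shared by all three.
  Yet \<open>P, y, z\<close> over \<open>v\<close> is congruent to a triple having a common hub at distance \<open>t\<close>; the common
  hub could be added to \<open>X\<close>.\<close>

section \<open>Metric betweenness\<close>

definition mbetween :: "'a::metric_space \<Rightarrow> 'a \<Rightarrow> 'a \<Rightarrow> bool" where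
  "mbetween x y z \<longleftrightarrow> dist x z = dist x y + dist y z"

lemma mbetween_sym: "mbetween x y z \<Longrightarrow> mbetween z y x"
  by (simp add: mbetween_def dist_commute)

lemma mbetween_refl [simp]: "mbetween x x y" "mbetween x y y"
  by (simp_all add: mbetween_def)

lemma mbetween_trans:
  assumes "mbetween w x z" "mbetween x y z"
  shows "mbetween w x y" "mbetween w y z"
  using assms dist_triangle[of w z y] dist_triangle[of w y x]
  by (simp_all add: mbetween_def)

lemma mbetween_trans2:
  assumes "mbetween w y z" "mbetween w x y"
  shows "mbetween x y z" "mbetween w x z"
  using assms dist_triangle[of w z x] dist_triangle[of x z y]
  by (simp_all add: mbetween_def)

section \<open>Points on geodesics and extension of isometries\<close>

locale homogeneous_geodesic =
  fixes M :: "'a::metric_space set"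
  assumes homogeneous: "all_set_homogeneous M"
    and geodesic: "geodesic_space M"
begin

lemma geodesic_path:
  assumes "x \<in> M" "y \<in> M"
  obtains c :: "real \<Rightarrow> 'a" where "c 0 = x" "c (dist x y) = y"
    "\<And>s. 0 \<le> s \<Longrightarrow> s \<le> dist x y \<Longrightarrow> c s \<in> M"
    "\<And>s t. 0 \<le> s \<Longrightarrow> s \<le> dist x y \<Longrightarrow> 0 \<le> t \<Longrightarrow> t \<le> dist x y \<Longrightarrow> dist (c s) (c t) = \<bar>s - t\<bar>"
proof -
  obtain a b \<gamma> where g: "a \<le> b" "geodesic_on M {a..b} \<gamma>" "\<gamma> a = x" "\<gamma> b = y"
    using geodesic assms unfolding geodesic_space_def geodesic_between_def by blast
  have im: "\<And>s. s \<in> {a..b} \<Longrightarrow> \<gamma> s \<in> M"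
    and d: "\<And>s t. s \<in> {a..b} \<Longrightarrow> t \<in> {a..b} \<Longrightarrow> dist (\<gamma> s) (\<gamma> t) = dist s t"
    using g(2) unfolding geodesic_on_def distance_preserving_on_def by auto
  have ab: "dist x y = b - a"
    using d[of a b] g by (simp add: dist_real_def)
  show thesis
  proof
    show "\<gamma> (a + 0) = x" "\<gamma> (a + dist x y) = y" using g ab by auto
    show "\<gamma> (a + s) \<in> M" if "0 \<le> s" "s \<le> dist x y" for s
      using that im ab by auto
    show "dist (\<gamma> (a + s)) (\<gamma> (a + t)) = \<bar>s - t\<bar>"
      if "0 \<le> s" "s \<le> dist x y" "0 \<le> t" "t \<le> dist x y" for s t
      using that d[of "a + s" "a + t"] ab by (auto simp: dist_real_def)
  qed
qed

lemma point_between: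
  assumes "x \<in> M" "y \<in> M" "0 \<le> r" "r \<le> dist x y"
  obtains z where "z \<in> M" "mbetween x z y" "dist x z = r"
proof -
  obtain c where c: "c 0 = x" "c (dist x y) = y"
    "\<And>s. 0 \<le> s \<Longrightarrow> s \<le> dist x y \<Longrightarrow> c s \<in> M"
    "\<And>s t. 0 \<le> s \<Longrightarrow> s \<le> dist x y \<Longrightarrow> 0 \<le> t \<Longrightarrow> t \<le> dist x y \<Longrightarrow> dist (c s) (c t) = \<bar>s - t\<bar>"
    using geodesic_path assms by blast
  show thesis
  proof
    show "c r \<in> M" using c assms by blast
    show d: "dist x (c r) = r" using c(4)[of 0 r] c(1) assms by simp
    have "dist (c r) y = dist x y - r" using c(4)[of r "dist x y"] c(2) assms by simp
    then show "mbetween x (c r) y" using d by (simp add: mbetween_def)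
  qed
qed

lemma isometry_extension:
  assumes "A \<subseteq> M" "f ` A \<subseteq> M" "\<And>x y. x \<in> A \<Longrightarrow> y \<in> A \<Longrightarrow> dist (f x) (f y) = dist x y"
  obtains g where "isometry_between M M g" "\<And>x. x \<in> A \<Longrightarrow> g x = f x"
proof -
  have "inj_on f A"
    using assms(3) by (metis dist_eq_0_iff inj_onI)
  then have "isometry_between A (f ` A) f"
    using assms(3) by (simp add: isometry_between_def distance_preserving_on_def bij_betw_def)
  with homogeneous assms(1,2)
  have "\<exists>g. isometry_between M M g \<and> (\<forall>x\<in>A. g x = f x)"
    unfolding all_set_homogeneous_def by auto
  then obtain g where "isometry_between M M g" "\<forall>x\<in>A. g x = f x"
    by (elim exE conjE)
  then show thesis by (intro that[of g]) simp_all
qed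

text \<open>Indexing allows points to coincide: equal distances make \<open>x i = x j\<close> force
  \<open>y i = y j\<close>, so the index picked by \<open>SOME\<close> does not matter. The index
  set may be infinite, as the limit argument for hubs requires.\<close>

lemma isometry_extension_family:
  assumes "\<And>i. i \<in> I \<Longrightarrow> x i \<in> M" "\<And>i. i \<in> I \<Longrightarrow> y i \<in> M"
    and d: "\<And>i j. i \<in> I \<Longrightarrow> j \<in> I \<Longrightarrow> dist (x i) (x j) = dist (y i) (y j)"
  obtains g where "isometry_between M M g" "\<And>i. i \<in> I \<Longrightarrow> g (x i) = y i"
proof -
  define f where "f p = y (SOME i. i \<in> I \<and> x i = p)" for p
  have f: "f (x i) = y i" if "i \<in> I" for i
  proof -
    let ?j = "SOME j. j \<in> I \<and> x j = x i"
    have "\<exists>j. j \<in> I \<and> x j = x i" using that by blast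
    then have "?j \<in> I \<and> x ?j = x i" by (rule someI_ex)
    then have "dist (y ?j) (y i) = 0" using d[of ?j i] that by simp
    then show ?thesis by (simp add: f_def)
  qed
  obtain g where "isometry_between M M g" "\<And>p. p \<in> x ` I \<Longrightarrow> g p = f p"
    by (rule isometry_extension[of "x ` I" f]) (use assms f in auto)
  then show thesis using f that by simp
qed

lemma isometry_extension4:
  assumes "x1 \<in> M" "x2 \<in> M" "x3 \<in> M" "x4 \<in> M" "y1 \<in> M" "y2 \<in> M" "y3 \<in> M" "y4 \<in> M"
    and "dist x1 x2 = dist y1 y2" "dist x1 x3 = dist y1 y3" "dist x1 x4 = dist y1 y4"
    and "dist x2 x3 = dist y2 y3" "dist x2 x4 = dist y2 y4" "dist x3 x4 = dist y3 y4"
  obtains g where "isometry_between M M g" "g x1 = y1" "g x2 = y2" "g x3 = y3" "g x4 = y4"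
proof -
  have I: "{..<4} = {0, 1, 2, 3::nat}" by auto
  obtain g where g: "isometry_between M M g"
    "\<And>i. i \<in> {..<4} \<Longrightarrow> g ([x1, x2, x3, x4] ! i) = [y1, y2, y3, y4] ! i"
    by (rule isometry_extension_family[of "{..<4}" "(!) [x1, x2, x3, x4]" "(!) [y1, y2, y3, y4]"])
      (use assms in \<open>auto simp: I dist_commute\<close>)
  show thesis
    using g(2)[of 0] g(2)[of 1] g(2)[of 2] g(2)[of 3] by (intro that[OF g(1)]) simp_all
qed

lemma isometry_extension3:
  assumes "x1 \<in> M" "x2 \<in> M" "x3 \<in> M" "y1 \<in> M" "y2 \<in> M" "y3 \<in> M"
    and "dist x1 x2 = dist y1 y2" "dist x1 x3 = dist y1 y3" "dist x2 x3 = dist y2 y3"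
  obtains g where "isometry_between M M g" "g x1 = y1" "g x2 = y2" "g x3 = y3"
  by (rule isometry_extension4[of x1 x2 x3 x3 y1 y2 y3 y3]) (use assms in auto)

lemma isometry_simps:
  assumes "isometry_between M M g"
  shows "x \<in> M \<Longrightarrow> g x \<in> M"
    and "x \<in> M \<Longrightarrow> y \<in> M \<Longrightarrow> dist (g x) (g y) = dist x y"
    and "x \<in> M \<Longrightarrow> y \<in> M \<Longrightarrow> z \<in> M \<Longrightarrow> mbetween (g x) (g y) (g z) \<longleftrightarrow> mbetween x y z"
  using assms
  by (auto simp: isometry_between_def distance_preserving_on_def bij_betw_def mbetween_def)

section \<open>Farthest hubs: trimming, invariance and existence\<close>

definition farthest_hub :: "'a \<Rightarrow> 'a \<Rightarrow> 'a \<Rightarrow> 'a \<Rightarrow> bool" where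
  "farthest_hub w v p q \<longleftrightarrow> w \<in> M \<and> v \<in> M \<and> p \<in> M \<and> q \<in> M \<and> mbetween w v p \<and> mbetween w v q \<and>
     (\<forall>z\<in>M. mbetween w z p \<longrightarrow> mbetween w z q \<longrightarrow> dist w z \<le> dist w v)"

lemma farthest_hub_in:
  assumes "farthest_hub w v p q"
  shows "w \<in> M" "v \<in> M" "p \<in> M" "q \<in> M" "mbetween w v p" "mbetween w v q"
  using assms by (auto simp: farthest_hub_def)

lemma farthest_hub_sym: "farthest_hub w v p q \<Longrightarrow> farthest_hub w v q p"
  by (auto simp: farthest_hub_def)

lemma farthest_hub_irrefl: "farthest_hub w v p p \<Longrightarrow> p = v"
  by (force simp: farthest_hub_def mbetween_def)

text \<open>A point on the way from \<open>w\<close> to \<open>x\<close> and \<open>y\<close> is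
  also on the way to \<open>p\<close> and \<open>q\<close>, so shorter arms have no farther
  hub.\<close>

lemma farthest_hub_trim:
  assumes K: "farthest_hub w v p q" and "x \<in> M" "mbetween v x p" "y \<in> M" "mbetween v y q"
  shows "farthest_hub w v x y"
proof -
  note i = farthest_hub_in[OF K]
  have x: "mbetween w v x" "mbetween w x p" and y: "mbetween w v y" "mbetween w y q"
    using mbetween_trans i assms by blast+
  have "dist w z \<le> dist w v" if "z \<in> M" "mbetween w z x" "mbetween w z y" for z
    using K that mbetween_trans2(2)[OF x(2)] mbetween_trans2(2)[OF y(2)] by (auto simp: farthest_hub_def)
  then show ?thesis using x y assms i by (auto simp: farthest_hub_def)
qed

text \<open>Every hub over \<open>u\<close> is a hub over \<open>w\<close>, and its distance from
  \<open>w\<close> is larger by the constant \<open>dist w u\<close>.\<close>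

lemma farthest_hub_trim_base:
  assumes K: "farthest_hub w v p q" and u: "u \<in> M" "mbetween w u v"
  shows "farthest_hub u v p q"
proof -
  note i = farthest_hub_in[OF K]
  have p: "mbetween u v p" "mbetween w u p" and q: "mbetween u v q" "mbetween w u q"
    using mbetween_trans2 i u by blast+
  have "dist u z \<le> dist u v" if z: "z \<in> M" "mbetween u z p" "mbetween u z q" for z
  proof -
    have "mbetween w u z" "mbetween w z p" "mbetween w z q"
      using mbetween_trans z p q by blast+
    then have "dist w z \<le> dist w v" using K z by (auto simp: farthest_hub_def)
    then show ?thesis using \<open>mbetween w u z\<close> u by (simp add: mbetween_def)
  qed
  then show ?thesis using p q u i by (auto simp: farthest_hub_def)
qed

lemma farthest_hub_isometry:
  assumes g: "isometry_between M M g" and K: "farthest_hub w v p q"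
  shows "farthest_hub (g w) (g v) (g p) (g q)"
proof -
  note i = farthest_hub_in[OF K]
  have "dist (g w) z \<le> dist (g w) (g v)"
    if z: "z \<in> M" "mbetween (g w) z (g p)" "mbetween (g w) z (g q)" for z
  proof -
    obtain z' where "z' \<in> M" "z = g z'"
      using g z(1) by (auto simp: isometry_between_def bij_betw_def)
    then show ?thesis
      using z i K isometry_simps[OF g] by (auto simp: farthest_hub_def)
  qed
  then show ?thesis using i isometry_simps[OF g] by (auto simp: farthest_hub_def)
qed

text \<open>The triangle \<open>w p q\<close> alone determines how far its farthest hub is from \<open>w\<close>.\<close>

lemma hub_le_farthest_hub:
  assumes K: "farthest_hub w v p q" and z: "w' \<in> M" "p' \<in> M" "q' \<in> M" "z \<in> M"
    and b: "mbetween w' z p'" "mbetween w' z q'"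
    and d: "dist w' p' = dist w p" "dist w' q' = dist w q" "dist p' q' = dist p q"
  shows "dist w' z \<le> dist w v"
proof -
  obtain g where g: "isometry_between M M g" "g w' = w" "g p' = p" "g q' = q"
    using isometry_extension3[of w' p' q' w p q] farthest_hub_in[OF K] z d by metis
  have "mbetween w (g z) p" "mbetween w (g z) q" "dist w (g z) = dist w' z"
    using isometry_simps[OF g(1)] g z b by metis+
  then show ?thesis
    using K isometry_simps(1)[OF g(1), of z] z by (auto simp: farthest_hub_def)
qed

text \<open>Homogeneity supplies the limit. Hubs with distances from \<open>w\<close> tending to the
  supremum \<open>L\<close> are chosen one beyond the other; this sequence is isometric to points of
  a geodesic from \<open>w\<close> to \<open>p\<close>, which does contain the point at distance
  \<open>L\<close>.\<close>

lemma farthest_hub_exists: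
  assumes w: "w \<in> M" "p \<in> M" "q \<in> M"
  obtains v where "farthest_hub w v p q"
proof -
  define H where "H = {z \<in> M. mbetween w z p \<and> mbetween w z q}"
  define L where "L = Sup (dist w ` H)"
  have wH: "w \<in> H" using w by (auto simp: H_def)
  have bdd: "bdd_above (dist w ` H)"
    by (rule bdd_aboveI[of _ "dist w p"]) (auto simp: H_def mbetween_def)
  have leL: "dist w z \<le> L" if "z \<in> H" for z
    unfolding L_def using bdd that by (intro cSup_upper) auto
  have Lp: "L \<le> dist w p" "L \<le> dist w q"
    using wH by (auto simp: L_def H_def mbetween_def intro!: cSup_least)
  have L0: "0 \<le> L" using leL[OF wH] by simp
  have step: "\<exists>z'. z' \<in> H \<and> mbetween w z z' \<and> L - e < dist w z'" if z: "z \<in> H" and "e > 0" for z e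
  proof (cases "L - e < dist w z")
    case True
    then show ?thesis using z by auto
  next
    case False
    have "\<exists>x\<in>dist w ` H. L - e < x"
      using wH \<open>e > 0\<close> bdd less_cSup_iff[of "dist w ` H" "L - e"] by (auto simp: L_def[symmetric])
    then obtain z2 where z2: "z2 \<in> H" "L - e < dist w z2" by auto
    \<comment> \<open>\<open>u\<close> and \<open>z\<close> are hubs at the same distance from
      \<open>w\<close>, hence also equally far from \<open>p\<close> and from \<open>q\<close>. An
      isometry fixing \<open>w, p, q\<close> and taking \<open>u\<close> to \<open>z\<close> moves
      the better hub \<open>z2\<close> beyond \<open>z\<close>.\<close>
    obtain u where u: "u \<in> M" "mbetween w u z2" "dist w u = dist w z"
      using point_between[of w z2 "dist w z"] w z2 False by (auto simp: H_def)
    have up: "mbetween w u p" "mbetween w u q"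
      using u z2 mbetween_trans2(2) by (auto simp: H_def)
    obtain g where g: "isometry_between M M g" "g w = w" "g u = z" "g p = p" "g q = q"
      by (rule isometry_extension4[of w u p q w z p q]) (use w u z up in \<open>auto simp: H_def mbetween_def\<close>)
    have m: "u \<in> M" "z \<in> M" "z2 \<in> M" using u z z2 by (auto simp: H_def)
    have "g z2 \<in> H" "mbetween w z (g z2)" "dist w (g z2) = dist w z2"
      using isometry_simps(1)[OF g(1), of z2] isometry_simps(2)[OF g(1), of w z2]
        isometry_simps(3)[OF g(1), of w z2 p] isometry_simps(3)[OF g(1), of w z2 q]
        isometry_simps(3)[OF g(1), of w u z2] g w m z2 u by (auto simp: H_def)
    then show ?thesis using z2 by auto
  qed
  have "\<exists>f. f 0 = w \<and> (\<forall>n. f n \<in> H) \<and>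
      (\<forall>n. mbetween w (f n) (f (Suc n)) \<and> L - inverse (real (Suc n)) < dist w (f (Suc n)))"
  proof -
    have "\<exists>f. \<forall>n. (f n \<in> H \<and> (n = 0 \<longrightarrow> f n = w)) \<and>
        mbetween w (f n) (f (Suc n)) \<and> L - inverse (real (Suc n)) < dist w (f (Suc n))"
      by (rule dependent_nat_choice) (use wH step in auto)
    then show ?thesis by blast
  qed
  then obtain f where f0: "f 0 = w" and fH: "\<And>n. f n \<in> H"
    and fb: "\<And>n. mbetween w (f n) (f (Suc n))"
    and fL: "\<And>n. L - inverse (real (Suc n)) < dist w (f (Suc n))"
    by auto
  have fbb: "mbetween w (f m) (f n)" if "m \<le> n" for m n
    using that
  proof (induction n rule: dec_induct)
    case (step n)
    then show ?case using fb[of n] mbetween_trans2(2) by blast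
  qed simp
  have fd: "dist (f m) (f n) = \<bar>dist w (f m) - dist w (f n)\<bar>" for m n
    using fbb[of m n] fbb[of n m] by (cases "m \<le> n") (auto simp: mbetween_def dist_commute)
  obtain c where c: "c 0 = w" "c (dist w p) = p"
    "\<And>s. 0 \<le> s \<Longrightarrow> s \<le> dist w p \<Longrightarrow> c s \<in> M"
    "\<And>s t. 0 \<le> s \<Longrightarrow> s \<le> dist w p \<Longrightarrow> 0 \<le> t \<Longrightarrow> t \<le> dist w p \<Longrightarrow> dist (c s) (c t) = \<bar>s - t\<bar>"
    using geodesic_path w by blast
  have t: "0 \<le> dist w (f n)" "dist w (f n) \<le> L" "dist w (f n) \<le> dist w p" for n
    using leL[OF fH] Lp by (auto intro: order_trans)
  \<comment> \<open>The isometry puts the whole sequence on the image of \<open>c\<close>, so the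
    image of \<open>c L\<close> is its limit.\<close>
  obtain g where g: "isometry_between M M g" "\<And>n. g (c (dist w (f n))) = f n"
    by (rule isometry_extension_family[of UNIV "\<lambda>n. c (dist w (f n))" f])
      (use c(3,4) t fd fH in \<open>auto simp: H_def\<close>)
  define v where "v = g (c L)"
  have cL: "c L \<in> M" using c(3) L0 Lp by blast
  have vM: "v \<in> M" using isometry_simps(1)[OF g(1)] cL by (simp add: v_def)
  have fv: "dist (f n) v = L - dist w (f n)" for n
    using isometry_simps(2)[OF g(1) _ cL, of "c (dist w (f n))"] g(2)[of n] c(3,4) t L0 Lp
    by (auto simp: v_def)
  have wv: "dist w v = L" using fv[of 0] f0 by simp
  \<comment> \<open>Betweenness passes to the limit, because \<open>dist (f n) v\<close> tends to
    0.\<close>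
  have vb: "mbetween w v x" if x: "L \<le> dist w x" "\<And>n. mbetween w (f n) x" for x
  proof -
    have "\<bar>dist v x - (dist w x - L)\<bar> \<le> 0 + e" if "e > 0" for e
    proof -
      obtain n where n: "inverse (real (Suc n)) < e / 2"
        using reals_Archimedean[of "e / 2"] \<open>e > 0\<close> by auto
      let ?y = "f (Suc n)"
      have "dist ?y x = dist w x - dist w ?y" using x(2)[of "Suc n"] by (simp add: mbetween_def)
      moreover have "\<bar>dist v x - dist ?y x\<bar> \<le> dist ?y v"
        using dist_triangle[of v x ?y] dist_triangle[of ?y x v] by (simp add: dist_commute abs_le_iff)
      ultimately show ?thesis using fv[of "Suc n"] fL[of n] n by linarith
    qed
    then have "\<bar>dist v x - (dist w x - L)\<bar> \<le> 0" by (rule field_le_epsilon)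
    then show ?thesis using wv by (simp add: mbetween_def)
  qed
  have "mbetween w v p" "mbetween w v q"
    using vb[OF Lp(1)] vb[OF Lp(2)] fH by (auto simp: H_def)
  then have "farthest_hub w v p q"
    using w vM leL wv by (auto simp: farthest_hub_def H_def)
  then show thesis using that by blast
qed

section \<open>Arm lengths determine the distance of the ends\<close>

text \<open>Suppose both arms at \<open>v'\<close> are shorter by the same positive amount. Moving
  the base \<open>w\<close> by that amount towards \<open>v\<close> gives a triangle
  \<open>u p q\<close> congruent to \<open>w' p' q'\<close>, yet \<open>v'\<close> is farther from
  \<open>w'\<close> than \<open>v\<close> is from \<open>u\<close>.\<close>

lemma farthest_hub_arm_le:
  assumes K: "farthest_hub w v p q" and m: "w' \<in> M" "v' \<in> M" "p' \<in> M" "q' \<in> M"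
    and b: "mbetween w' v' p'" "mbetween w' v' q'"
    and d: "dist w' v' = dist w v" "dist p' q' = dist p q"
      "dist v p - dist v' p' = dist v q - dist v' q'" "dist v p - dist v' p' \<le> dist w v"
  shows "dist v p \<le> dist v' p'"
proof (rule ccontr)
  assume gt: "\<not> ?thesis"
  note i = farthest_hub_in[OF K]
  obtain u where u: "u \<in> M" "mbetween w u v" "dist w u = dist v p - dist v' p'"
    using point_between[of w v "dist v p - dist v' p'"] i d gt by auto
  have Ku: "farthest_hub u v p q" using farthest_hub_trim_base K u by blast
  have "dist w' v' \<le> dist u v"
    by (rule hub_le_farthest_hub[OF Ku, of w' p' q'])
      (use m b d u farthest_hub_in[OF Ku] in \<open>auto simp: mbetween_def\<close>)
  then show False using d u gt by (simp add: mbetween_def)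
qed

text \<open>If \<open>p'\<close> and \<open>q'\<close> were too far apart, both could be pulled back
  equally along their arms until their distance is \<open>dist p q\<close>. The shortened arms then
  contradict \<open>farthest_hub_arm_le\<close>.\<close>

lemma farthest_hub_dist_le:
  assumes K: "farthest_hub w v p q" and K': "farthest_hub w' v' p' q'"
    and d: "dist w' v' = dist w v" "dist v' p' = dist v p" "dist v' q' = dist v q"
      "dist v p \<le> dist v q" "dist v p \<le> dist w v"
  shows "dist p' q' \<le> dist p q"
proof (rule ccontr)
  assume gt: "\<not> ?thesis"
  note i = farthest_hub_in[OF K] and i' = farthest_hub_in[OF K']
  define s e where "s = dist v p" and "e = dist v q - dist v p"
  have dp: "dist v' p' = s" and dq: "dist v' q' = s + e" and se: "0 \<le> s" "0 \<le> e"
    using d by (auto simp: s_def e_def)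
  obtain c1 where c1: "c1 0 = v'" "c1 s = p'" "\<And>x. 0 \<le> x \<Longrightarrow> x \<le> s \<Longrightarrow> c1 x \<in> M"
    "\<And>x y. 0 \<le> x \<Longrightarrow> x \<le> s \<Longrightarrow> 0 \<le> y \<Longrightarrow> y \<le> s \<Longrightarrow> dist (c1 x) (c1 y) = \<bar>x - y\<bar>"
    using geodesic_path[of v' p'] i' unfolding dp by blast
  obtain c2 where c2: "c2 0 = v'" "c2 (s + e) = q'" "\<And>x. 0 \<le> x \<Longrightarrow> x \<le> s + e \<Longrightarrow> c2 x \<in> M"
    "\<And>x y. 0 \<le> x \<Longrightarrow> x \<le> s + e \<Longrightarrow> 0 \<le> y \<Longrightarrow> y \<le> s + e \<Longrightarrow> dist (c2 x) (c2 y) = \<bar>x - y\<bar>"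
    using geodesic_path[of v' q'] i' unfolding dq by blast
  \<comment> \<open>The offset \<open>e\<close> preserves the difference of the arm lengths. At 0
    the value is \<open>e\<close>, at most \<open>dist p q\<close> by the triangle inequality, so
    the intermediate value theorem applies.\<close>
  define \<phi> where "\<phi> x = dist (c1 x) (c2 (x + e))" for x
  have "continuous_on {0..s} c1"
    unfolding continuous_on_iff using c1(4) by (force simp: dist_real_def)
  moreover have "continuous_on {0..s} (\<lambda>x. c2 (x + e))"
    unfolding continuous_on_iff using c2(4) se by (force simp: dist_real_def)
  ultimately have cont: "continuous_on {0..s} \<phi>"
    unfolding \<phi>_def by (intro continuous_intros)
  have "\<phi> 0 = e" using c1 c2 c2(4)[of 0 e] se by (simp add: \<phi>_def)
  moreover have "e \<le> dist p q"
    using dist_triangle[of v q p] by (simp add: e_def)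
  moreover have "\<phi> s = dist p' q'" using c1 c2 by (simp add: \<phi>_def)
  ultimately obtain x where x: "0 \<le> x" "x \<le> s" "\<phi> x = dist p q"
    using IVT'[OF _ _ se(1) cont, of "dist p q"] gt by auto
  have "x \<noteq> s" using x gt \<open>\<phi> s = dist p' q'\<close> by auto
  have dx: "dist v' (c1 x) = x" "dist v' (c2 (x + e)) = x + e"
    using c1(4)[of 0 x] c2(4)[of 0 "x + e"] c1(1) c2(1) x se by auto
  have "mbetween v' (c1 x) p'" "mbetween v' (c2 (x + e)) q'"
    using dx dp dq c1(2) c2(2) c1(4)[of x s] c2(4)[of "x + e" "s + e"] x se by (auto simp: mbetween_def)
  then have "mbetween w' v' (c1 x)" "mbetween w' v' (c2 (x + e))"
    using mbetween_trans i' by blast+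
  then have "dist v p \<le> dist v' (c1 x)"
    using c1(3)[of x] c2(3)[of "x + e"] x se d dx i'
    by (intro farthest_hub_arm_le[OF K, of w' v' "c1 x" "c2 (x + e)"])
      (auto simp: \<phi>_def s_def e_def)
  then show False using dx x \<open>x \<noteq> s\<close> by (simp add: s_def)
qed

lemma farthest_hub_dist_eq:
  assumes "farthest_hub w v p q" "farthest_hub w' v' p' q'"
    and "dist w' v' = dist w v" "dist v' p' = dist v p" "dist v' q' = dist v q"
      "dist v p \<le> dist v q" "dist v p \<le> dist w v"
  shows "dist p' q' = dist p q"
  using farthest_hub_dist_le[OF assms(1,2)] farthest_hub_dist_le[OF assms(2,1)] assms by simp

section \<open>Arms that meet again\<close>

text \<open>Suppose \<open>dist v h > t\<close> and let \<open>h'\<close> be the point at distance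
  \<open>t\<close> on the way to \<open>h\<close>. The triangles \<open>w a h'\<close> and
  \<open>x' a h'\<close> are congruent, so \<open>x\<close> is a farthest hub over
  \<open>x'\<close>. The pair \<open>h, a\<close> seen from \<open>x\<close> then has the same arm
  lengths as \<open>a', h'\<close> seen from \<open>v\<close>, hence the same distance. But
  \<open>a', h'\<close> arises from \<open>a, h\<close> by shortening both arms by
  \<open>dist v h - t\<close>, against \<open>farthest_hub_arm_le\<close>.\<close>

lemma no_long_arm:
  assumes K: "farthest_hub w v a h" and b: "mbetween v a x" "mbetween v h x"
    and d: "dist v a = t" "dist v x = 2 * t" "t \<le> dist w v"
    and x: "x \<in> M" "x' \<in> M" "mbetween v x x'" "dist x x' = dist w v"
  shows "dist v h \<le> t"
proof (rule ccontr)
  assume gt: "\<not> ?thesis"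
  note i = farthest_hub_in[OF K]
  have t: "0 \<le> t" using d by (metis zero_le_dist)
  obtain h' where h': "h' \<in> M" "mbetween v h' h" "dist v h' = t"
    using point_between[of v h t] i gt t by auto
  have Kh': "farthest_hub w v a h'"
    using farthest_hub_trim[OF K, of a h'] i h' by simp
  have hx: "mbetween h' h x" "mbetween v h' x"
    using mbetween_trans2 b h' by blast+
  have x'a: "mbetween x' x a" "mbetween x' x h'"
    using mbetween_trans2(1) x b hx mbetween_sym by blast+
  have "dist x' z \<le> dist x' x" if "z \<in> M" "mbetween x' z a" "mbetween x' z h'" for z
  proof -
    have "dist x' z \<le> dist w v"
      by (rule hub_le_farthest_hub[OF Kh', of x' a h'])
        (use that x h' i farthest_hub_in[OF Kh'] x'a d hx b in \<open>auto simp: mbetween_def dist_commute\<close>)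
    then show ?thesis using x by (simp add: dist_commute)
  qed
  then have Kx: "farthest_hub x' x a h'"
    using x i h' x'a by (auto simp: farthest_hub_def)
  have Kx': "farthest_hub x' x h a"
    by (rule farthest_hub_sym, rule farthest_hub_trim[OF Kx])
      (use i mbetween_sym hx in auto)
  have xh: "dist x h = 2 * t - dist v h" "dist x a = t"
    using b d by (auto simp: mbetween_def dist_commute)
  obtain a' where a': "a' \<in> M" "mbetween v a' a" "dist v a' = 2 * t - dist v h"
    using point_between[of v a "2 * t - dist v h"] i gt d xh zero_le_dist[of x h] by auto
  have Ka': "farthest_hub w v a' h'"
    using farthest_hub_trim[OF K] a' h' by blast
  have eq: "dist a' h' = dist h a"
    by (rule farthest_hub_dist_eq[OF Kx' Ka'])
      (use x xh a' h' gt d in \<open>auto simp: dist_commute\<close>)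
  have "dist v a \<le> dist v a'"
    by (rule farthest_hub_arm_le[OF K, of w v a' h'])
      (use i a' h' eq d xh gt farthest_hub_in[OF Ka'] zero_le_dist[of x h] in \<open>auto simp: dist_commute\<close>)
  then show False using a' d gt by simp
qed

text \<open>Both bases are moved to distance exactly \<open>t\<close> from their hubs, which makes
  \<open>farthest_hub_dist_eq\<close> applicable.\<close>

lemma dist_arms_eq:
  assumes "farthest_hub w v p q" "farthest_hub w' v' p' q'"
    and "t \<le> dist w v" "t \<le> dist w' v'"
    and "dist v p = t" "dist v q = t" "dist v' p' = t" "dist v' q' = t"
  shows "dist p q = dist p' q'"
proof -
  have t: "0 \<le> t" using assms by auto
  have "\<exists>u. farthest_hub u v p q \<and> dist u v = t"
    if K: "farthest_hub w v p q" "t \<le> dist w v" for w v p q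
  proof -
    obtain u where u: "u \<in> M" "mbetween w u v" "dist w u = dist w v - t"
      using point_between[of w v "dist w v - t"] farthest_hub_in[OF K(1)] K(2) t by auto
    then show ?thesis
      using farthest_hub_trim_base[OF K(1) u(1,2)] by (auto simp: mbetween_def)
  qed
  then obtain u u' where "farthest_hub u v p q" "dist u v = t" "farthest_hub u' v' p' q'" "dist u' v' = t"
    using assms(1-4) by metis
  then show ?thesis
    using farthest_hub_dist_eq[of u' v' p' q' u v p q] assms by simp
qed

text \<open>The contradiction compares \<open>P, y, z\<close>, whose pairwise hubs over \<open>v\<close> are the independent
  points \<open>a, b, n\<close>, with the triple \<open>a, b, n\<close> itself, which has \<open>v\<close> as a common hub over \<open>u\<close>.\<close>

lemma no_closing_arms:
  assumes K: "farthest_hub w v P Q"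
    and t: "0 < t" "2 * t \<le> dist w v" "dist v P = 2 * t" "dist v Q = 2 * t"
    and P': "P' \<in> M" "mbetween v P P'" "dist P P' = dist w v"
    and ab: "farthest_hub w v a b" "mbetween v a P" "mbetween v b P" "dist v a = t" "dist v b = t"
  shows False
proof -
  note i = farthest_hub_in[OF K] and iab = farthest_hub_in[OF ab(1)]
  have irr: "\<not> farthest_hub w v e e" if "dist v e = t" for e
    using farthest_hub_irrefl[of w v e] that t by auto
  have deq: "dist p q = dist a b"
    if "farthest_hub w v p q" "dist v p = t" "dist v q = t" for p q
    using dist_arms_eq[OF that(1) ab(1), of t] that ab t by simp
  define S where "S = {e \<in> M. mbetween v e P \<and> dist v e = t}"
  \<comment> \<open>Keeping \<open>a\<close> and \<open>b\<close> in every family guarantees two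
    distinct members of the maximal family.\<close>
  define F where "F = {X. {a, b} \<subseteq> X \<and> X \<subseteq> S \<and> (\<forall>e\<in>X. \<forall>e'\<in>X. e \<noteq> e' \<longrightarrow> farthest_hub w v e e')}"
  have "{a, b} \<in> F"
    using ab iab farthest_hub_sym by (auto simp: F_def S_def)
  moreover have "\<Union>C \<in> F" if "C \<noteq> {}" "subset.chain F C" for C
  proof -
    have C: "\<And>X. X \<in> C \<Longrightarrow> X \<in> F" "\<And>X Y. X \<in> C \<Longrightarrow> Y \<in> C \<Longrightarrow> X \<subseteq> Y \<or> Y \<subseteq> X"
      using that(2) by (auto simp: subset_chain_def)
    have "farthest_hub w v e e'" if e: "e \<in> X" "X \<in> C" "e' \<in> Y" "Y \<in> C" "e \<noteq> e'" for e e' X Y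
    proof -
      obtain Z where "Z \<in> C" "e \<in> Z" "e' \<in> Z"
        using C(2)[OF e(2,4)] e by blast
      then show ?thesis using C(1)[of Z] e(5) by (simp add: F_def)
    qed
    moreover have "{a, b} \<subseteq> \<Union>C" "\<Union>C \<subseteq> S"
      using C(1) \<open>C \<noteq> {}\<close> by (auto simp: F_def)
    ultimately show ?thesis by (simp add: F_def)
  qed
  ultimately obtain X where X: "X \<in> F" and max: "\<And>Y. Y \<in> F \<Longrightarrow> X \<subseteq> Y \<Longrightarrow> Y = X"
    using subset_Zorn_nonempty[of F] by (metis empty_iff)
  have XS: "X \<subseteq> S" and aX: "a \<in> X" and bX: "b \<in> X"
    and XK: "\<And>e e'. e \<in> X \<Longrightarrow> e' \<in> X \<Longrightarrow> e \<noteq> e' \<Longrightarrow> farthest_hub w v e e'"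
    using X by (auto simp: F_def)
  have ab_ne: "a \<noteq> b" using irr ab by auto
  \<comment> \<open>The copies \<open>a'\<close> and \<open>n\<close> of \<open>a\<close> and
    \<open>b\<close> lie on the way to \<open>Q\<close>, so each has farthest hub \<open>v\<close>
    with every member of \<open>X\<close>.\<close>
  obtain g0 where g0: "isometry_between M M g0" "g0 w = w" "g0 v = v" "g0 P = Q"
    by (rule isometry_extension3[of w v P w v Q]) (use i t in \<open>auto simp: mbetween_def\<close>)
  define a' where "a' = g0 a"
  define n where "n = g0 b"
  have an: "farthest_hub w v a' n" "mbetween v a' Q" "mbetween v n Q" "dist v a' = t" "dist v n = t"
    using farthest_hub_isometry[OF g0(1) ab(1)] isometry_simps(2,3)[OF g0(1)] g0 ab i iab
    by (auto simp: a'_def n_def) metis+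
  note ian = farthest_hub_in[OF an(1)]
  have KXQ: "farthest_hub w v e Q" if "e \<in> X" for e
    by (rule farthest_hub_trim[OF K]) (use that XS i in \<open>auto simp: S_def\<close>)
  have KX: "farthest_hub w v e e'" if "e \<in> X" "e' \<in> M" "mbetween v e' Q" for e e'
    by (rule farthest_hub_trim[OF K]) (use that XS in \<open>auto simp: S_def\<close>)
  \<comment> \<open>All distances between independent arms of length \<open>t\<close> are equal, so
    replacing \<open>a'\<close> by \<open>c\<close> while fixing \<open>w\<close>, \<open>v\<close>,
    \<open>n\<close> and the rest of \<open>X\<close> is distance-preserving. The point sought is
    the image of \<open>Q\<close>.\<close>
  have closing: "\<exists>y. y \<in> M \<and> dist v y = 2 * t \<and> mbetween v c y \<and> mbetween v n y \<and>
      (\<forall>e\<in>X - {c}. farthest_hub w v y e)" if c: "c \<in> X" for c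
  proof -
    define f where "f p = (if p = a' then c else p)" for p
    define D where "D = insert a' ({w, v, n} \<union> (X - {c}))"
    have cS: "c \<in> M" "dist v c = t" "mbetween w v c"
      using c XS farthest_hub_in[OF KXQ[OF c]] by (auto simp: S_def)
    have da: "dist c p = dist a' p" if p: "p \<in> {w, v, n} \<union> (X - {c})" for p
    proof -
      consider "p = w" | "p = v" | "p = n" | "p \<in> X" "p \<noteq> c" using p by blast
      then show ?thesis
      proof cases
        case 3
        then show ?thesis
          using deq[OF KX[OF c, of n]] deq[OF an(1)] ian an cS by simp
      next
        case 4
        then have "dist v p = t" using XS by (auto simp: S_def)
        then show ?thesis
          using 4 deq[OF XK[OF c, of p]] deq[OF KX[of p a']] ian an cS by (simp add: dist_commute)
      qed (use ian an cS in \<open>auto simp: mbetween_def dist_commute\<close>)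
    qed
    have da': "dist p c = dist p a'" if "p \<in> {w, v, n} \<union> (X - {c})" for p
      using da[OF that] by (simp add: dist_commute)
    have nD: "a' \<notin> {w, v, n} \<union> (X - {c})"
    proof
      assume "a' \<in> {w, v, n} \<union> (X - {c})"
      then show False
        using da irr an KX[of a' a'] ian cS t
        by (auto simp: mbetween_def dist_commute)
    qed
    obtain g where g: "isometry_between M M g" "\<And>p. p \<in> D \<Longrightarrow> g p = f p"
    proof (rule isometry_extension[of D f])
      show "D \<subseteq> M" using ian XS by (auto simp: D_def S_def)
      then show "f ` D \<subseteq> M" using cS by (auto simp: f_def)
      show "dist (f p) (f q) = dist p q" if "p \<in> D" "q \<in> D" for p q
        using that da da' nD unfolding D_def f_def by auto
    qed blast
    have gf: "g w = w" "g v = v" "g n = n" "g a' = c" "\<And>e. e \<in> X - {c} \<Longrightarrow> g e = e"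
      using g(2) nD unfolding D_def f_def by auto
    have "farthest_hub w v (g Q) e" if e: "e \<in> X - {c}" for e
      using farthest_hub_isometry[OF g(1) farthest_hub_sym[OF KXQ[of e]]] gf e by simp
    moreover have "mbetween v c (g Q)" "mbetween v n (g Q)" "g Q \<in> M" "dist v (g Q) = 2 * t"
      using isometry_simps(3)[OF g(1), of v a' Q] isometry_simps(3)[OF g(1), of v n Q]
        isometry_simps(1)[OF g(1), of Q] isometry_simps(2)[OF g(1), of v Q] gf an ian i t by auto
    ultimately show ?thesis by blast
  qed
  obtain y where y: "y \<in> M" "dist v y = 2 * t" "mbetween v a y" "mbetween v n y"
    "\<And>e. e \<in> X \<Longrightarrow> e \<noteq> a \<Longrightarrow> farthest_hub w v y e"
    using closing[OF aX] by blast
  obtain z where z: "z \<in> M" "dist v z = 2 * t" "mbetween v b z" "mbetween v n z"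
    "\<And>e. e \<in> X \<Longrightarrow> e \<noteq> b \<Longrightarrow> farthest_hub w v z e"
    using closing[OF bX] by blast
  \<comment> \<open>A common hub \<open>h\<close> of \<open>p\<close> and \<open>q\<close> over
    \<open>v\<close> lies on the way to \<open>q\<close>, hence has farthest hub \<open>v\<close>
    with \<open>d\<close>. Since \<open>p\<close> is reached through both \<open>d\<close> and
    \<open>h\<close>, \<open>no_long_arm\<close> bounds \<open>dist v h\<close> by \<open>t\<close>,
    so \<open>c\<close> is a farthest hub.\<close>
  have pair: "dist p q = dist a b"
    if p: "p \<in> M" "dist v p = 2 * t" "mbetween v c p" "mbetween v d p"
      and q: "q \<in> M" "dist v q = 2 * t" "mbetween v c q" "farthest_hub w v q d"
      and c: "c \<in> M" "dist v c = t" and d: "dist v d = t" for p q c d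
  proof -
    obtain g where g: "isometry_between M M g" "g v = v" "g P = p"
      by (rule isometry_extension3[of v P P v p p]) (use i p t in auto)
    have p': "g P' \<in> M" "mbetween v p (g P')" "dist p (g P') = dist w v"
      using isometry_simps(1)[OF g(1), of P'] isometry_simps(2)[OF g(1), of P P']
        isometry_simps(3)[OF g(1), of v P P'] g i P' by auto
    have "dist v h \<le> dist v c" if h: "h \<in> M" "mbetween v h p" "mbetween v h q" for h
    proof -
      have "farthest_hub w v d h"
        using farthest_hub_trim[OF q(4), of h d] h farthest_hub_in[OF q(4)] farthest_hub_sym by auto
      from no_long_arm[OF this p(4) h(2) d p(2) _ p(1) p'] show ?thesis using c t by simp
    qed
    then have "farthest_hub v c p q"
      using i c p q by (auto simp: farthest_hub_def)
    from dist_arms_eq[OF this ab(1), of t] show ?thesis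
      using c p q t ab by (simp add: mbetween_def)
  qed
  have Py: "dist P y = dist a b"
    by (rule pair[of P a b y]) (use i ab iab y bX ab_ne t in auto)
  have Pz: "dist P z = dist a b"
    by (rule pair[of P b a z]) (use i ab iab z aX ab_ne t in auto)
  have yz: "dist y z = dist a b"
    by (rule pair[of y n a z]) (use y z an ian ab aX ab_ne in auto)
  have Kan: "farthest_hub w v a n" "farthest_hub w v b n"
    using KX aX bX ian an by blast+
  have an_d: "dist a n = dist a b" "dist b n = dist a b"
    using deq Kan an ab by blast+
  \<comment> \<open>With \<open>dist u v = t\<close>, the points \<open>a, b, n\<close> are at
    distance \<open>2 * t\<close> from \<open>u\<close>, just as \<open>P, y, z\<close> are from
    \<open>v\<close>.\<close>
  obtain u where u: "u \<in> M" "mbetween w u v" "dist w u = dist w v - t"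
    using point_between[of w v "dist w v - t"] i t by auto
  have Ku: "farthest_hub u v a b" "farthest_hub u v a n"
    using farthest_hub_trim_base u ab(1) Kan by blast+
  note iu = farthest_hub_in[OF Ku(1)] farthest_hub_in[OF Ku(2)]
  have uv: "dist u v = t" using u by (simp add: mbetween_def)
  obtain g where g: "isometry_between M M g" "g u = v" "g a = P" "g b = y" "g n = z"
    by (rule isometry_extension4[of u a b n v P y z]) (use iu i y z uv ab an t Py Pz yz an_d in \<open>auto simp: mbetween_def\<close>)
  define h where "h = g v"
  have h: "h \<in> M" "mbetween v h P" "mbetween v h y" "mbetween v h z" "dist v h = t"
    using isometry_simps(1)[OF g(1), of v] isometry_simps(2)[OF g(1), of u v]
      isometry_simps(3)[OF g(1), of u v a] isometry_simps(3)[OF g(1), of u v b]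
      isometry_simps(3)[OF g(1), of u v n] g iu uv by (auto simp: h_def)
  \<comment> \<open>\<open>h\<close> lies on the way to \<open>y\<close> and to \<open>z\<close>:
    \<open>y\<close> handles all members of \<open>X\<close> except \<open>a\<close>, and
    \<open>z\<close> handles \<open>a\<close>.\<close>
  have hK: "farthest_hub w v h e" if e: "e \<in> X" for e
  proof (cases "e = a")
    case True
    then show ?thesis
      using farthest_hub_trim[OF z(5)[OF aX ab_ne], of h a] h iab by simp
  next
    case False
    have "e \<in> M" using e XS by (auto simp: S_def)
    then show ?thesis
      using farthest_hub_trim[OF y(5)[OF e False], of h e] h by simp
  qed
  have "insert h X \<in> F"
    using X h hK farthest_hub_sym[OF hK] by (auto simp: F_def S_def)
  then have "h \<in> X" using max[of "insert h X"] by blast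
  then show False using hK[of h] irr[of h] h by simp
qed

section \<open>Uniqueness for close points\<close>

text \<open>Cutting the two geodesics at their farthest hub \<open>v\<close> over \<open>w\<close> and trimming the arms yields
  a pair that closes up again at distance \<open>2 * t\<close>: seen from \<open>e\<close>, the pair is congruent to what is seen
  from \<open>w\<close>, so the hub over \<open>w\<close> has a mirror image over \<open>e\<close>.\<close>

lemma close_pairs_unique:
  assumes xy: "x1 \<in> M" "y1 \<in> M" "0 < dist x1 y1"
    and m: "x \<in> M" "y \<in> M" "10 * dist x y \<le> dist x1 y1"
    and p: "p \<in> M" "mbetween x p y" and q: "q \<in> M" "mbetween x q y" and pq: "dist x p = dist x q"
  shows "p = q"
proof (rule ccontr)
  assume ne: "p \<noteq> q"
  \<comment> \<open>A third of the long geodesic serves as base before the close pair, and the rest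
    leaves room for a tail of length \<open>A\<close> behind it; the factor 10 makes
    \<open>s\<close> small enough for this.\<close>
  define A s where "A = dist x1 y1 / 3" and "s = dist x y"
  have As: "0 < A" "0 \<le> s" "10 * s \<le> 3 * A" and d1: "dist x1 y1 = 3 * A"
    using xy m by (auto simp: A_def s_def)
  obtain c where c: "c 0 = x1" "c (3 * A) = y1"
    "\<And>r. 0 \<le> r \<Longrightarrow> r \<le> 3 * A \<Longrightarrow> c r \<in> M"
    "\<And>r r'. 0 \<le> r \<Longrightarrow> r \<le> 3 * A \<Longrightarrow> 0 \<le> r' \<Longrightarrow> r' \<le> 3 * A \<Longrightarrow> dist (c r) (c r') = \<bar>r - r'\<bar>"
    using geodesic_path[OF xy(1,2)] unfolding d1 by blast
  have cb: "mbetween (c r) (c r') (c r'')" if "0 \<le> r" "r \<le> r'" "r' \<le> r''" "r'' \<le> 3 * A" for r r' r''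
    using that c(4) by (simp add: mbetween_def)
  define w0 v0 u0 where "w0 = c 0" and "v0 = c A" and "u0 = c (A + s)"
  have cM: "w0 \<in> M" "v0 \<in> M" "u0 \<in> M" using c(3) As by (auto simp: w0_def v0_def u0_def)
  have dc: "dist w0 v0 = A" "dist v0 u0 = s"
    using c(4) As by (auto simp: w0_def v0_def u0_def)
  have b0: "mbetween w0 v0 u0" using cb As by (auto simp: w0_def v0_def u0_def)
  obtain g where g: "isometry_between M M g" "g x = v0" "g y = u0"
    by (rule isometry_extension3[of x y y v0 u0 u0]) (use m cM dc in \<open>auto simp: s_def\<close>)
  define P Q where "P = g p" and "Q = g q"
  have PQ: "P \<in> M" "Q \<in> M" "mbetween v0 P u0" "mbetween v0 Q u0" "dist v0 P = dist v0 Q" "P \<noteq> Q"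
    using isometry_simps(1)[OF g(1), of p] isometry_simps(1)[OF g(1), of q]
      isometry_simps(2)[OF g(1), of x p] isometry_simps(2)[OF g(1), of x q]
      isometry_simps(3)[OF g(1), of x p y] isometry_simps(3)[OF g(1), of x q y]
      isometry_simps(2)[OF g(1), of p q] g m p q pq ne by (force simp: P_def Q_def)+
  have wP: "mbetween w0 v0 P" "mbetween w0 v0 Q" "mbetween w0 P u0" "mbetween w0 Q u0"
    using mbetween_trans b0 PQ by blast+
  obtain v where v: "farthest_hub w0 v P Q" using farthest_hub_exists cM PQ by blast
  note iv = farthest_hub_in[OF v]
  have vA: "A \<le> dist w0 v" using v wP cM dc by (auto simp: farthest_hub_def)
  define t where "t = dist v P / 2"
  have vP: "dist v P = 2 * t" "dist v Q = 2 * t"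
    using iv wP PQ by (auto simp: t_def mbetween_def)
  have t: "0 < t"
  proof (rule ccontr)
    assume "\<not> 0 < t"
    then have "dist v P = 0" "dist v Q = 0" using vP zero_le_dist[of v P] by linarith+
    then show False using PQ by simp
  qed
  have vs: "dist w0 v + 2 * t \<le> A + s"
    using iv wP b0 dc vP zero_le_dist[of P u0] unfolding mbetween_def by linarith
  obtain w where w: "w \<in> M" "mbetween w0 w v" "dist w0 w = dist w0 v - A"
    using point_between[of w0 v "dist w0 v - A"] iv vA As by auto
  have wv: "dist w v = A" using w by (simp add: mbetween_def)
  have K: "farthest_hub w v P Q" using farthest_hub_trim_base[OF v] w by blast
  note iK = farthest_hub_in[OF K]
  obtain a where a: "a \<in> M" "mbetween v a P" "dist v a = t"
    using point_between[of v P t] iv vP t by auto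
  obtain b where b: "b \<in> M" "mbetween v b Q" "dist v b = t"
    using point_between[of v Q t] iv vP t by auto
  have Kab: "farthest_hub w v a b" using farthest_hub_trim[OF K] a b by blast
  note iab = farthest_hub_in[OF Kab]
  \<comment> \<open>This puts \<open>e\<close> at distance \<open>A + 2 * t\<close> beyond
    \<open>v\<close>, so that \<open>e\<close> and \<open>w\<close> are both at distance
    \<open>A + t\<close> from \<open>a\<close> and \<open>b\<close>.\<close>
  define l where "l = dist w0 v + 2 * t + A"
  have l: "A + s \<le> l" "l \<le> 3 * A" using vA vs t As by (auto simp: l_def)
  define e where "e = c l"
  have e: "e \<in> M" "dist w0 e = l" "mbetween w0 u0 e"
    using c(3,4) cb l As by (auto simp: e_def w0_def u0_def)
  have "mbetween w0 a u0" "mbetween w0 b u0" "mbetween w0 v a" "mbetween w0 v b"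
    using mbetween_trans mbetween_trans2 iv a b wP by meson+
  then have web: "mbetween w0 a e" "mbetween w0 b e" and wab: "mbetween w0 v a" "mbetween w0 v b"
    using mbetween_trans2(2) e by blast+
  have ve: "mbetween w0 v e" using mbetween_trans2(2) web wab by blast
  have de: "dist e a = A + t" "dist e b = A + t" "dist v e = A + 2 * t" "dist w e = 2 * A + 2 * t"
    using web wab ve e a b w iv mbetween_trans2(2)[OF ve w(2)]
    by (auto simp: mbetween_def l_def dist_commute)
  obtain g1 where g1: "isometry_between M M g1" "g1 w = e" "g1 a = a" "g1 b = b"
    by (rule isometry_extension3[of w a b e a b]) (use w a b e iab wv de in \<open>auto simp: mbetween_def\<close>)
  define x0 where "x0 = g1 v"
  have x0: "x0 \<in> M" "dist e x0 = A" "dist x0 a = t" "dist x0 b = t"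
    using isometry_simps(1)[OF g1(1), of v] isometry_simps(2)[OF g1(1), of w v]
      isometry_simps(2)[OF g1(1), of v a] isometry_simps(2)[OF g1(1), of v b] g1 iab wv a b
    by (auto simp: x0_def)
  \<comment> \<open>The path through \<open>a\<close> gives the upper bound \<open>2 * t\<close> for
    \<open>dist v x0\<close>; the lower bound is \<open>dist v e - dist e x0\<close>.\<close>
  have dx: "dist v x0 = 2 * t" "dist w x0 = A + 2 * t"
    using dist_triangle[of v x0 a] dist_triangle[of v e x0] dist_triangle[of w e x0]
      dist_triangle[of w x0 v] x0 a de wv by (auto simp: dist_commute)
  have bx: "mbetween v a x0" "mbetween v b x0" "mbetween v x0 e"
    using dx x0 a b de by (auto simp: mbetween_def dist_commute)
  \<comment> \<open>Taking the meeting point \<open>x0\<close> to \<open>P\<close> places both arms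
    on the way to \<open>P\<close>, and \<open>e\<close> becomes the required extension beyond
    \<open>P\<close>.\<close>
  obtain g2 where g2: "isometry_between M M g2" "g2 w = w" "g2 v = v" "g2 x0 = P"
    by (rule isometry_extension3[of w v x0 w v P]) (use w iK x0 dx vP wv in \<open>auto simp: mbetween_def\<close>)
  note g2s = isometry_simps(1)[OF g2(1)] isometry_simps(2)[OF g2(1), of v]
    isometry_simps(2)[OF g2(1), of x0] isometry_simps(3)[OF g2(1), of v]
  show False
  proof (rule no_closing_arms[OF K, of t "g2 e" "g2 a" "g2 b"])
    show "farthest_hub w v (g2 a) (g2 b)"
      using farthest_hub_isometry[OF g2(1) Kab] g2 by simp
    show "g2 e \<in> M" using g2s(1) e by blast
    show "mbetween v P (g2 e)" using g2s(4)[of x0 e] g2 iK x0 e bx by simp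
    show "dist P (g2 e) = dist w v" using g2s(3)[of e] g2 x0 e wv by (simp add: dist_commute)
    show "mbetween v (g2 a) P" "mbetween v (g2 b) P"
      using g2s(4)[of a x0] g2s(4)[of b x0] g2 iK x0 a b bx by simp_all
    show "dist v (g2 a) = t" "dist v (g2 b) = t"
      using g2s(2)[of a] g2s(2)[of b] g2 iK a b by simp_all
    show "2 * t \<le> dist w v" using vs vA As wv by simp
  qed (use t vP in auto)
qed

end

section \<open>From unique points to unique geodesics\<close>

lemma geodesic_between_memD:
  assumes "geodesic_between M x y S" "z \<in> S"
  shows "z \<in> M" "mbetween x z y"
  using assms
  by (auto simp: geodesic_between_def geodesic_on_def distance_preserving_on_def mbetween_def dist_real_def)

lemma geodesic_between_point:
  fixes x :: "'a::metric_space"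
  assumes "geodesic_between M x y S" "0 \<le> r" "r \<le> dist x y"
  obtains z where "z \<in> S" "dist x z = r"
proof -
  obtain a b and \<gamma> :: "real \<Rightarrow> 'a"
    where g: "a \<le> b" "distance_preserving_on {a..b} \<gamma>" "\<gamma> a = x" "\<gamma> b = y" "S = \<gamma> ` {a..b}"
    using assms(1) unfolding geodesic_between_def geodesic_on_def by blast
  have d: "dist (\<gamma> s) (\<gamma> t) = \<bar>s - t\<bar>" if "s \<in> {a..b}" "t \<in> {a..b}" for s t
    using g(2) that by (simp add: distance_preserving_on_def dist_real_def)
  have "a + r \<in> {a..b}" using d[of a b] g assms by simp
  then show thesis using that[of "\<gamma> (a + r)"] d[of a "a + r"] g assms by simp
qed

theorem proposition3p1:
  fixes M :: "'a::metric_space set"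
  assumes "all_set_homogeneous M"
    and "geodesic_space M"
  shows "locally_unique_geodesics M"
proof -
  interpret homogeneous_geodesic M
    using assms by unfold_locales
  have ex: "\<exists>S. geodesic_between M x y S" if "x \<in> M" "y \<in> M" for x y
    using assms(2) that by (simp add: geodesic_space_def)
  show ?thesis
    unfolding locally_unique_geodesics_def
  proof
    fix p assume p: "p \<in> M"
    obtain e where e: "0 < e" and uniq: "\<And>x y z z'. \<lbrakk>x \<in> M \<inter> ball p e; y \<in> M \<inter> ball p e; z \<in> M; z' \<in> M;
        mbetween x z y; mbetween x z' y; dist x z = dist x z'\<rbrakk> \<Longrightarrow> z = z'"
    proof (cases "M = {p}")
      case True
      then show thesis by (intro that[of 1]) auto
    next
      case False
      then obtain q where q: "q \<in> M" "q \<noteq> p" using p by blast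
      show thesis
      proof (rule that)
        \<comment> \<open>Two points of this ball are less than \<open>dist p q / 10\<close> apart,
          as \<open>close_pairs_unique\<close> requires.\<close>
        show "0 < dist p q / 20" using q by simp
        fix x y z z'
        assume xy: "x \<in> M \<inter> ball p (dist p q / 20)" "y \<in> M \<inter> ball p (dist p q / 20)"
          and z: "z \<in> M" "z' \<in> M" "mbetween x z y" "mbetween x z' y" "dist x z = dist x z'"
        have "10 * dist x y \<le> dist p q"
          using xy dist_triangle[of x y p] by (simp add: dist_commute)
        then show "z = z'"
          using close_pairs_unique[of p q x y z z'] p q xy z by simp
      qed
    qed
    \<comment> \<open>\<open>S'\<close> has a point at the same distance from \<open>x\<close> as a
      given \<open>z\<close> in \<open>S\<close>, and by \<open>uniq\<close> that point is
      \<open>z\<close>.\<close>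
    have sub: "S \<subseteq> S'" if x: "x \<in> M \<inter> ball p e" "y \<in> M \<inter> ball p e"
      and S: "geodesic_between M x y S" "geodesic_between M x y S'" for x y S S'
    proof
      fix z assume "z \<in> S"
      then have z: "z \<in> M" "mbetween x z y" using geodesic_between_memD[OF S(1)] by auto
      obtain z' where z': "z' \<in> S'" "dist x z' = dist x z"
        using geodesic_between_point[OF S(2), of "dist x z"] z by (auto simp: mbetween_def)
      then show "z \<in> S'"
        using uniq[OF x z(1) _ z(2), of z'] geodesic_between_memD[OF S(2) z'(1)] by simp
    qed
    show "\<exists>U V. openin (top_of_set M) V \<and> p \<in> V \<and> V \<subseteq> U \<and> U \<subseteq> M \<and>
        (\<forall>x\<in>U. \<forall>y\<in>U. \<exists>!S. geodesic_between M x y S)"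
    proof (intro exI[of _ "M \<inter> ball p e"] conjI ballI)
      show "openin (top_of_set M) (M \<inter> ball p e)" by (simp add: openin_open_Int)
      show "p \<in> M \<inter> ball p e" using p e by simp
      show "\<exists>!S. geodesic_between M x y S" if xy: "x \<in> M \<inter> ball p e" "y \<in> M \<inter> ball p e" for x y
      proof -
        obtain S where S: "geodesic_between M x y S" using ex xy by blast
        show ?thesis
        proof (rule ex1I[of _ S])
          show "geodesic_between M x y S" by (fact S)
          show "S' = S" if "geodesic_between M x y S'" for S'
            by (intro subset_antisym sub[OF xy] S that)
        qed
      qed
    qed auto
  qed
qed

end
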